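(* Let $A^{1,\dots,k}$ be a multipartition matrix such that $I(A^{1,\dots,k})$ is an iterated toric fiber product of linear ideals. Then $A^{1,\dots,k}$ is well-connected and satisfies the generalized running intersection property (GRIP).
   Context: Write $[r]=\{1,\dots,r\}$. A partition matrix with $m$ columns is a $0/1$ matrix each of whose columns has exactly one entry equal to $1$; it is assumed to have no zero rows. A multipartition matrix $A=A^{1,\dots,k}$ with $k$ partitions is the matrix obtained by stacking partition matrices $A^1,\dots,A^k$, all with $m$ columns (the ordered list is part of the data). Let $a^\ell_i$ be the $i$-th row of $A^\ell$ and $I^\ell_i\subset[m]$ its support. $A^{1,\dots,\ell}$ denotes the stacking of the first $\ell$ partitions, and $c^\ell_j$ the number of columns of $A^{1,\dots,\ell}$ equal to its $j$-th column (the $j$-th included). Well-connected: $A$ is well-connected if for every row $a^\ell_u$ with $\ell>1$ one has $c^\ell_j/c^{\ell-1}_j=c^\ell_{j'}/c^{\ell-1}_{j'}$ for all $j,j'\in I^\ell_u$. The matrix $\Cup_{n=1}^{\ell}A^n$: let $\beta$ be the number of distinct columns of $A^{1,\dots,\ell}$ and $\lambda:[m]\to[\beta]$ a surjective labeling with $\lambda(j)=\lambda(j')$ iff the $j$-th and $j'$-th columns of $A^{1,\dots,\ell}$ are equal. Then $\Cup_{n=1}^{\ell}A^n$ is the $\beta\times m$ partition matrix whose $j$-th column is the standard basis vector $e_{\lambda(j)}$. Florets: let $B,C$ be partition matrices with $m$ columns; $BC$ denotes $B$ stacked above $C$ (a multipartition matrix with two partitions). A row of $B$ and a row of $C$ are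 connected if their supports intersect. $BC$ satisfies the floret condition if for any two rows of $B$, the sets of rows of $C$ connected to them are disjoint or equal. In that case the set of rows of $C$ connected to a given row of $B$ is a floret of $C$; let $\mathcal{F}^C_1,\dots,\mathcal{F}^C_f$ be the distinct florets of $C$, and $\mathcal{F}^B_t$ the set of rows of $B$ connected to rows of $\mathcal{F}^C_t$. $B\Cap C$ is the $f\times m$ matrix whose $(t,j)$ entry is $1$ if the row of $C$ having $j$ in its support lies in $\mathcal{F}^C_t$, and $0$ otherwise. GRIP: with $B_\ell=\Cup_{n=1}^{\ell}A^n$, the matrix $A^{1,\dots,k}$ satisfies the GRIP if for each $\ell\in[k-1]$: (1) $B_\ell A^{\ell+1}$ is well-connected; (2) $B_\ell A^{\ell+1}$ satisfies the floret condition; (3) the rows of $B_\ell\Cap A^{\ell+1}$ lie in the rowspan of $A^{1,\dots,\ell}$. Toric ideals: for a nonnegative integer matrix $M$, $I(M)=\langle p^a-p^b: a,b \text{ nonnegative integer vectors with } Ma=Mb\rangle$ in the polynomial ring over $\mathbb{C}$ with one variable per column of $M$. A matrix $\bar M$ is a compression of $M$ if $M$ and $\bar M$ have the same underlying set of columns and $\bar M$ contains at most as many copies of each column as $M$. Toric fiber product: given ideals $I\subset\mathbb{C}[x^i_j]$, $J\subset\mathbb{C}[y^i_k]$ homogeneous with respect to multigradings $\deg x^i_j=\deg y^i_k=\mathbf{d}^i$, the toric fiber product is the kernel of $\mathbb{C}[z^i_{jk}]\to\mathbb{C}[x]/I\otimes_{\mathbb{C}}\mathbb{C}[y]/J$,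 $z^i_{jk}\mapsto x^i_j\otimes y^i_k$, with one variable $z^i_{jk}$ for each pair $(x^i_j,y^i_k)$ of the same superscript $i$. It is defined when both ideals are homogeneous with respect to the multigradings. Iterated toric fiber product of linear ideals: $I(A^{1,\dots,k})$ is one if for each $\ell\in[k-1]$, (i) $B_\ell$ and $A^{\ell+1}$ satisfy the floret condition, and (ii) with $D_\ell=B_\ell\Cap A^{\ell+1}$, there exist compressions $\tilde A^{1,\dots,\ell}$ of $A^{1,\dots,\ell}$ and $\tilde A^{\ell+1}$ of $A^{\ell+1}$ such that the toric fiber product $I(\tilde A^{1,\dots,\ell})\times_{D_\ell}I(\tilde A^{\ell+1})$ is defined and equal to $I(A^{1,\dots,\ell+1})$. Here the multigrading given by $D_\ell$ assigns degree $e_t$ to the variable of a column of $\tilde A^{1,\dots,\ell}$ with label $u$ (i.e. equal to the columns of $A^{1,\dots,\ell}$ labelled $u$ by $\lambda$) when row $u$ of $B_\ell$ lies in $\mathcal{F}^{B_\ell}_t$, and degree $e_t$ to the variable of a column $e_v$ of $\tilde A^{\ell+1}$ when row $v$ of $A^{\ell+1}$ lies in $\mathcal{F}^{A^{\ell+1}}_t$. The equality of ideals is understood under an identification of variables in which the variables of the fiber product (pairs of a column of $\tilde A^{1,\dots,\ell}$ and a column of $\tilde A^{\ell+1}$ of the same degree) correspond bijectively to the columns of $A^{1,\dots,\ell+1}$, each pair corresponding to a column that is the concatenation of the two columns in the pair. *)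

theory Defs
  imports
    "HOL-Library.Poly_Mapping"
    "HOL-Algebra.QuotRing"
    "Jordan_Normal_Form.VS_Connect"
begin

section \<open>Partition matrices\<close>

text \<open>Rows, columns and partitions are indexed from 0, so the partition written
  \<open>A\<^sup>\<ell>\<close> in the usual 1-based numbering is \<open>As ! (\<ell> - 1)\<close>.\<close>

definition partition_matrix :: "nat \<Rightarrow> nat mat \<Rightarrow> bool" where
  "partition_matrix m B \<longleftrightarrow>
     dim_col B = m \<and>
     elements_mat B \<subseteq> {0, 1} \<and>
     (\<forall>j<m. \<exists>!i. i < dim_row B \<and> B $$ (i, j) = 1) \<and>
     (\<forall>i<dim_row B. row B i \<noteq> 0\<^sub>v m)"

definition multipartition :: "nat \<Rightarrow> nat mat list \<Rightarrow> bool" where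
  "multipartition m As \<longleftrightarrow> As \<noteq> [] \<and> (\<forall>B\<in>set As. partition_matrix m B)"

definition stack :: "nat \<Rightarrow> nat mat list \<Rightarrow> nat mat" where
  "stack m As = foldr (@\<^sub>r) As (0\<^sub>m 0 m)"

definition row_support :: "nat mat \<Rightarrow> nat \<Rightarrow> nat set" where
  "row_support B i = {j. j < dim_col B \<and> B $$ (i, j) \<noteq> 0}"

definition col_count :: "nat \<Rightarrow> nat mat list \<Rightarrow> nat \<Rightarrow> nat \<Rightarrow> nat" where
  "col_count m As l j =
     card {j'. j' < m \<and> col (stack m (take l As)) j' = col (stack m (take l As)) j}"

definition well_connected :: "nat \<Rightarrow> nat mat list \<Rightarrow> bool" where
  "well_connected m As \<longleftrightarrow>
     (\<forall>l\<in>{2..length As}. \<forall>u<dim_row (As ! (l - 1)).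
        \<forall>j\<in>row_support (As ! (l - 1)) u. \<forall>j'\<in>row_support (As ! (l - 1)) u.
          real (col_count m As l j) / real (col_count m As (l - 1) j) =
          real (col_count m As l j') / real (col_count m As (l - 1) j'))"


section \<open>Column labelings, florets and the GRIP\<close>

text \<open>Column labelings and enumerations of florets are only determined up to a permutation of the
  labels; one of them is fixed by choice.\<close>

definition num_distinct_cols :: "nat mat \<Rightarrow> nat" where
  "num_distinct_cols M = card (set (cols M))"

definition col_label :: "nat mat \<Rightarrow> nat \<Rightarrow> nat" where
  "col_label M = (SOME lam. lam ` {..<dim_col M} = {..<num_distinct_cols M} \<and>
     (\<forall>j<dim_col M. \<forall>j'<dim_col M. lam j = lam j' \<longleftrightarrow> col M j = col M j'))"

lemma col_label_spec:
  "col_label M ` {..<dim_col M} = {..<num_distinct_cols M} \<and>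
     (\<forall>j<dim_col M. \<forall>j'<dim_col M. col_label M j = col_label M j' \<longleftrightarrow> col M j = col M j')"
proof -
  let ?P = "\<lambda>lam. lam ` {..<dim_col M} = {..<num_distinct_cols M} \<and>
    (\<forall>j<dim_col M. \<forall>j'<dim_col M. lam j = lam j' \<longleftrightarrow> col M j = col M j')"
  obtain h where h: "bij_betw h (set (cols M)) {0..<num_distinct_cols M}"
    unfolding num_distinct_cols_def using ex_bij_betw_finite_nat[of "set (cols M)"] by auto
  have cols: "set (cols M) = col M ` {..<dim_col M}"
    unfolding cols_def by auto
  have "inj_on h (set (cols M))" and "h ` set (cols M) = {0..<num_distinct_cols M}"
    using h by (auto simp: bij_betw_def)
  then have "?P (\<lambda>j. h (col M j))"
    unfolding cols by (simp add: image_image atLeast0LessThan inj_on_eq_iff)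
  then have "?P (SOME lam. ?P lam)"
    by (rule someI[of ?P])
  then show ?thesis
    unfolding col_label_def .
qed

text \<open>With \<open>M\<close> the stacking of \<open>A\<^sup>1, \<dots>, A\<^sup>\<ell>\<close>, this is the union (cup) of these partitions.\<close>

definition cup_matrix :: "nat mat \<Rightarrow> nat mat" where
  "cup_matrix M = mat (num_distinct_cols M) (dim_col M)
     (\<lambda>(i, j). if col_label M j = i then 1 else 0)"

definition connected_rows :: "nat mat \<Rightarrow> nat mat \<Rightarrow> nat \<Rightarrow> nat set" where
  "connected_rows B C u = {v. v < dim_row C \<and> row_support B u \<inter> row_support C v \<noteq> {}}"

definition floret_condition :: "nat mat \<Rightarrow> nat mat \<Rightarrow> bool" where
  "floret_condition B C \<longleftrightarrow>
     (\<forall>u<dim_row B. \<forall>u'<dim_row B.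
        connected_rows B C u \<inter> connected_rows B C u' = {} \<or>
        connected_rows B C u = connected_rows B C u')"

definition florets :: "nat mat \<Rightarrow> nat mat \<Rightarrow> nat set list" where
  "florets B C = (SOME Fs. distinct Fs \<and> set Fs = connected_rows B C ` {..<dim_row B})"

lemma florets_spec:
  "distinct (florets B C) \<and> set (florets B C) = connected_rows B C ` {..<dim_row B}"
  unfolding florets_def
  by (rule someI_ex) (use finite_distinct_list[of "connected_rows B C ` {..<dim_row B}"] in auto)

definition upper_floret :: "nat mat \<Rightarrow> nat mat \<Rightarrow> nat \<Rightarrow> nat set" where
  "upper_floret B C t =
     {u. u < dim_row B \<and> connected_rows B C u \<inter> florets B C ! t \<noteq> {}}"

definition cap_matrix :: "nat mat \<Rightarrow> nat mat \<Rightarrow> nat mat" where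
  "cap_matrix B C = mat (length (florets B C)) (dim_col C)
     (\<lambda>(t, j). if \<exists>v\<in>florets B C ! t. j \<in> row_support C v then 1 else 0)"

definition GRIP :: "nat \<Rightarrow> nat mat list \<Rightarrow> bool" where
  "GRIP m As \<longleftrightarrow>
     (\<forall>l\<in>{1..<length As}.
        let A = stack m (take l As); B = cup_matrix A; C = As ! l in
          well_connected m [B, C] \<and>
          floret_condition B C \<and>
          set (rows (map_mat real (cap_matrix B C)))
            \<subseteq> vec_space.row_space m (map_mat real A))"


section \<open>Polynomial rings and toric ideals\<close>

text \<open>\<open>poly_ring X\<close> is the polynomial ring over the complex numbers in the variables \<open>X\<close>: a
  polynomial maps each exponent vector to its coefficient.\<close>

type_synonym 'x cpoly = "('x \<Rightarrow>\<^sub>0 nat) \<Rightarrow>\<^sub>0 complex"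

definition poly_ring :: "'x set \<Rightarrow> 'x cpoly ring" where
  "poly_ring X = \<lparr>carrier = {f. \<forall>a\<in>Poly_Mapping.keys f. Poly_Mapping.keys a \<subseteq> X},
     monoid.mult = (*), one = 1, zero = 0, add = (+)\<rparr>"

abbreviation const_poly :: "complex \<Rightarrow> 'x cpoly" where
  "const_poly c \<equiv> Poly_Mapping.single 0 c"

abbreviation var_poly :: "'x \<Rightarrow> 'x cpoly" where
  "var_poly x \<equiv> Poly_Mapping.single (Poly_Mapping.single x 1) 1"

lemma poly_ring_simps:
  "mult (poly_ring X) = (*)" "one (poly_ring X) = 1" "zero (poly_ring X) = 0" "add (poly_ring X) = (+)"
  by (auto simp: poly_ring_def)

lemma poly_ring_carrier:
  "f \<in> carrier (poly_ring X) \<longleftrightarrow> (\<forall>a\<in>Poly_Mapping.keys f. Poly_Mapping.keys a \<subseteq> X)"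
  by (simp add: poly_ring_def)

lemma cring_poly_ring: "cring (poly_ring X)"
proof -
  let ?C = "carrier (poly_ring X)"
  have zero: "0 \<in> ?C" and one: "1 \<in> ?C" by (auto simp: poly_ring_carrier)
  have add: "f + g \<in> ?C" if "f \<in> ?C" "g \<in> ?C" for f g
    using that Poly_Mapping.keys_add[of f g] unfolding poly_ring_carrier by blast
  have uminus: "\<exists>g\<in>?C. f + g = 0" if "f \<in> ?C" for f
    by (rule bexI[of _ "- f"]) (use that in \<open>auto simp: poly_ring_carrier\<close>)
  have mult: "f * g \<in> ?C" if f: "f \<in> ?C" and g: "g \<in> ?C" for f g
    unfolding poly_ring_carrier
  proof
    fix c assume "c \<in> Poly_Mapping.keys (f * g)"
    then obtain a b where "c = a + b" "a \<in> Poly_Mapping.keys f" "b \<in> Poly_Mapping.keys g"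
      using Poly_Mapping.keys_mult[of f g] by auto
    then show "Poly_Mapping.keys c \<subseteq> X"
      using f g Poly_Mapping.keys_add[of a b] unfolding poly_ring_carrier by blast
  qed
  have "abelian_group (poly_ring X)"
    by (rule abelian_groupI) (simp_all add: poly_ring_simps zero add uminus add.assoc add.commute)
  moreover have "Group.comm_monoid (poly_ring X)"
    by (rule comm_monoidI) (simp_all add: poly_ring_simps one mult mult.assoc mult.commute)
  ultimately show ?thesis
    by (intro cringI) (simp_all add: poly_ring_simps distrib_right)
qed

definition toric_ideal :: "nat mat \<Rightarrow> nat cpoly set" where
  "toric_ideal M = genideal (poly_ring {..<dim_col M})
     {Poly_Mapping.single a 1 - Poly_Mapping.single b 1 | a b.
        Poly_Mapping.keys a \<subseteq> {..<dim_col M} \<and> Poly_Mapping.keys b \<subseteq> {..<dim_col M} \<and>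
        M *\<^sub>v vec (dim_col M) (Poly_Mapping.lookup a) =
        M *\<^sub>v vec (dim_col M) (Poly_Mapping.lookup b)}"

definition compression :: "nat mat \<Rightarrow> nat mat \<Rightarrow> bool" where
  "compression M' M \<longleftrightarrow>
     dim_row M' = dim_row M \<and> set (cols M') = set (cols M) \<and>
     mset (cols M') \<subseteq># mset (cols M)"

text \<open>The homomorphism from a polynomial ring to a commutative algebra \<open>R\<close> with structure map
  \<open>\<eta>\<close> that sends each variable \<open>x\<close> to \<open>\<phi> x\<close>.\<close>

definition poly_hom ::
    "('r, 's) ring_scheme \<Rightarrow> (complex \<Rightarrow> 'r) \<Rightarrow> ('x \<Rightarrow> 'r) \<Rightarrow> 'x cpoly \<Rightarrow> 'r" where
  "poly_hom R \<eta> \<phi> f =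
     (\<Oplus>\<^bsub>R\<^esub>a\<in>Poly_Mapping.keys f. \<eta> (Poly_Mapping.lookup f a) \<otimes>\<^bsub>R\<^esub>
        (\<Otimes>\<^bsub>R\<^esub>x\<in>Poly_Mapping.keys a. \<phi> x [^]\<^bsub>R\<^esub> Poly_Mapping.lookup a x))"


section \<open>Tensor products of commutative complex algebras\<close>

text \<open>An algebra is a commutative ring \<open>S\<close> together with a structure map \<open>\<eta>\<close> from the complex
  numbers. The free vector space on \<open>carrier S \<times> carrier T\<close>, with the multiplication extending
  \<open>(s, t) (s', t') = (s s', t t')\<close> bilinearly, is a commutative algebra; the tensor product is its
  quotient by the bilinearity relations. (Their linear span is already an ideal.)\<close>

definition tensor_free ::
    "('s, 'p) ring_scheme \<Rightarrow> ('t, 'q) ring_scheme \<Rightarrow> (('s \<times> 't) \<Rightarrow>\<^sub>0 complex) ring" where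
  "tensor_free S T = \<lparr>carrier = {f. Poly_Mapping.keys f \<subseteq> carrier S \<times> carrier T},
     monoid.mult = (\<lambda>f g. \<Sum>p\<in>Poly_Mapping.keys f. \<Sum>q\<in>Poly_Mapping.keys g.
       Poly_Mapping.single (fst p \<otimes>\<^bsub>S\<^esub> fst q, snd p \<otimes>\<^bsub>T\<^esub> snd q)
         (Poly_Mapping.lookup f p * Poly_Mapping.lookup g q)),
     one = Poly_Mapping.single (\<one>\<^bsub>S\<^esub>, \<one>\<^bsub>T\<^esub>) 1, zero = 0, add = (+)\<rparr>"

definition tensor_relations ::
    "('s, 'p) ring_scheme \<Rightarrow> (complex \<Rightarrow> 's) \<Rightarrow> ('t, 'q) ring_scheme \<Rightarrow> (complex \<Rightarrow> 't) \<Rightarrow>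
     (('s \<times> 't) \<Rightarrow>\<^sub>0 complex) set" where
  "tensor_relations S \<eta>S T \<eta>T =
     {Poly_Mapping.single (s \<oplus>\<^bsub>S\<^esub> s', t) 1 - Poly_Mapping.single (s, t) 1
        - Poly_Mapping.single (s', t) 1 | s s' t.
        s \<in> carrier S \<and> s' \<in> carrier S \<and> t \<in> carrier T} \<union>
     {Poly_Mapping.single (s, t \<oplus>\<^bsub>T\<^esub> t') 1 - Poly_Mapping.single (s, t) 1
        - Poly_Mapping.single (s, t') 1 | s t t'.
        s \<in> carrier S \<and> t \<in> carrier T \<and> t' \<in> carrier T} \<union>
     {Poly_Mapping.single (\<eta>S c \<otimes>\<^bsub>S\<^esub> s, t) 1 - Poly_Mapping.single (s, t) c | c s t.
        s \<in> carrier S \<and> t \<in> carrier T} \<union>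
     {Poly_Mapping.single (s, \<eta>T c \<otimes>\<^bsub>T\<^esub> t) 1 - Poly_Mapping.single (s, t) c | c s t.
        s \<in> carrier S \<and> t \<in> carrier T}"

definition tensor_ideal ::
    "('s, 'p) ring_scheme \<Rightarrow> (complex \<Rightarrow> 's) \<Rightarrow> ('t, 'q) ring_scheme \<Rightarrow> (complex \<Rightarrow> 't) \<Rightarrow>
     (('s \<times> 't) \<Rightarrow>\<^sub>0 complex) set" where
  "tensor_ideal S \<eta>S T \<eta>T = genideal (tensor_free S T) (tensor_relations S \<eta>S T \<eta>T)"

definition tensor_product ::
    "('s, 'p) ring_scheme \<Rightarrow> (complex \<Rightarrow> 's) \<Rightarrow> ('t, 'q) ring_scheme \<Rightarrow> (complex \<Rightarrow> 't) \<Rightarrow>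
     (('s \<times> 't) \<Rightarrow>\<^sub>0 complex) set ring" where
  "tensor_product S \<eta>S T \<eta>T = tensor_free S T Quot tensor_ideal S \<eta>S T \<eta>T"

definition pure_tensor ::
    "('s, 'p) ring_scheme \<Rightarrow> (complex \<Rightarrow> 's) \<Rightarrow> ('t, 'q) ring_scheme \<Rightarrow> (complex \<Rightarrow> 't) \<Rightarrow>
     's \<Rightarrow> 't \<Rightarrow> (('s \<times> 't) \<Rightarrow>\<^sub>0 complex) set" where
  "pure_tensor S \<eta>S T \<eta>T s t =
     a_r_coset (tensor_free S T) (tensor_ideal S \<eta>S T \<eta>T) (Poly_Mapping.single (s, t) 1)"

definition tensor_scalar ::
    "('s, 'p) ring_scheme \<Rightarrow> (complex \<Rightarrow> 's) \<Rightarrow> ('t, 'q) ring_scheme \<Rightarrow> (complex \<Rightarrow> 't) \<Rightarrow>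
     complex \<Rightarrow> (('s \<times> 't) \<Rightarrow>\<^sub>0 complex) set" where
  "tensor_scalar S \<eta>S T \<eta>T c = pure_tensor S \<eta>S T \<eta>T (\<eta>S c) \<one>\<^bsub>T\<^esub>"


section \<open>Toric fiber products\<close>

text \<open>The superscript of the variable \<open>x\<close> is \<open>ix x\<close>, and the variables with superscript \<open>i\<close> have
  the multidegree \<open>d i\<close>, an integer vector.\<close>

definition multidegree :: "('x \<Rightarrow> 'r \<Rightarrow> int) \<Rightarrow> ('x \<Rightarrow>\<^sub>0 nat) \<Rightarrow> 'r \<Rightarrow> int" where
  "multidegree deg a = (\<lambda>r. \<Sum>x\<in>Poly_Mapping.keys a. int (Poly_Mapping.lookup a x) * deg x r)"

definition homogeneous_component :: "('x \<Rightarrow> 'r \<Rightarrow> int) \<Rightarrow> ('r \<Rightarrow> int) \<Rightarrow> 'x cpoly \<Rightarrow> 'x cpoly" where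
  "homogeneous_component deg e f =
     (\<Sum>a | a \<in> Poly_Mapping.keys f \<and> multidegree deg a = e.
        Poly_Mapping.single a (Poly_Mapping.lookup f a))"

definition homogeneous_ideal :: "('x \<Rightarrow> 'r \<Rightarrow> int) \<Rightarrow> 'x cpoly set \<Rightarrow> bool" where
  "homogeneous_ideal deg I \<longleftrightarrow> (\<forall>f\<in>I. \<forall>e. homogeneous_component deg e f \<in> I)"

definition tfp_vars :: "'x set \<Rightarrow> ('x \<Rightarrow> 'i) \<Rightarrow> 'y set \<Rightarrow> ('y \<Rightarrow> 'i) \<Rightarrow> ('x \<times> 'y) set" where
  "tfp_vars X ix Y iy = {(x, y). x \<in> X \<and> y \<in> Y \<and> ix x = iy y}"

definition tfp_defined ::
    "('i \<Rightarrow> 'r \<Rightarrow> int) \<Rightarrow> ('x \<Rightarrow> 'i) \<Rightarrow> ('y \<Rightarrow> 'i) \<Rightarrow> 'x cpoly set \<Rightarrow> 'y cpoly set \<Rightarrow> bool" where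
  "tfp_defined d ix iy I J \<longleftrightarrow>
     homogeneous_ideal (\<lambda>x. d (ix x)) I \<and> homogeneous_ideal (\<lambda>y. d (iy y)) J"

definition toric_fiber_product ::
    "'x set \<Rightarrow> ('x \<Rightarrow> 'i) \<Rightarrow> 'x cpoly set \<Rightarrow> 'y set \<Rightarrow> ('y \<Rightarrow> 'i) \<Rightarrow> 'y cpoly set \<Rightarrow>
     ('x \<times> 'y) cpoly set" where
  "toric_fiber_product X ix I Y iy J =
     (let cosI = a_r_coset (poly_ring X) I; cosJ = a_r_coset (poly_ring Y) J;
          S = poly_ring X Quot I; \<eta>S = (\<lambda>c. cosI (const_poly c));
          T = poly_ring Y Quot J; \<eta>T = (\<lambda>c. cosJ (const_poly c))
      in a_kernel (poly_ring (tfp_vars X ix Y iy)) (tensor_product S \<eta>S T \<eta>T)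
           (poly_hom (tensor_product S \<eta>S T \<eta>T) (tensor_scalar S \<eta>S T \<eta>T)
              (\<lambda>(x, y). pure_tensor S \<eta>S T \<eta>T (cosI (var_poly x)) (cosJ (var_poly y)))))"


section \<open>Iterated toric fiber products\<close>

text \<open>The indices of the floret degrees assigned to a column of a compression of \<open>A\<close>, with respect
  to \<open>B = cup_matrix A\<close>, and to a column of a compression of \<open>C\<close>. If the floret condition holds,
  the index is unique.\<close>

definition upper_floret_index :: "nat mat \<Rightarrow> nat mat \<Rightarrow> nat vec \<Rightarrow> nat" where
  "upper_floret_index A C w = (THE t. t < length (florets (cup_matrix A) C) \<and>
     (\<exists>j<dim_col A. col A j = w \<and> col_label A j \<in> upper_floret (cup_matrix A) C t))"

definition lower_floret_index :: "nat mat \<Rightarrow> nat mat \<Rightarrow> nat vec \<Rightarrow> nat" where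
  "lower_floret_index A C w = (THE t. t < length (florets (cup_matrix A) C) \<and>
     (\<exists>v\<in>florets (cup_matrix A) C ! t. w = unit_vec (dim_row C) v))"

definition iterated_toric_fiber_product :: "nat \<Rightarrow> nat mat list \<Rightarrow> bool" where
  "iterated_toric_fiber_product m As \<longleftrightarrow>
     (\<forall>l\<in>{1..<length As}.
        let A = stack m (take l As); C = As ! l; A' = stack m (take (l + 1) As) in
          floret_condition (cup_matrix A) C \<and>
          (\<exists>At Ct. compression At A \<and> compression Ct C \<and>
             (let X = {..<dim_col At}; ix = (\<lambda>j. upper_floret_index A C (col At j));
                  Y = {..<dim_col Ct}; iy = (\<lambda>j. lower_floret_index A C (col Ct j));
                  e = (\<lambda>t s :: nat. if s = t then 1 else 0)
              in tfp_defined e ix iy (toric_ideal At) (toric_ideal Ct) \<and>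
                 (\<exists>\<sigma>. bij_betw \<sigma> (tfp_vars X ix Y iy) {..<m} \<and>
                    (\<forall>(i, j)\<in>tfp_vars X ix Y iy. col A' (\<sigma> (i, j)) = col At i @\<^sub>v col Ct j) \<and>
                    poly_hom (poly_ring {..<m}) const_poly (\<lambda>z. var_poly (\<sigma> z)) `
                      toric_fiber_product X ix (toric_ideal At) Y iy (toric_ideal Ct) =
                    toric_ideal A'))))"

end

theory Submission
  imports Defs
begin

text \<open>Well-connectedness is a counting argument. By the bijection between pairs of columns of equal
  degree and columns of \<open>A\<^sup>1, \<dots>, A\<^sup>\<ell>\<^sup>+\<^sup>1\<close>, the number \<open>c\<^sup>\<ell>\<^sup>+\<^sup>1\<^sub>j\<close> is the multiplicity of the upper part of
  the \<open>j\<close>-th column times that of its lower part \<open>b\<close> (in the two compressions), while \<open>c\<^sup>\<ell>\<^sub>j\<close> is the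
  multiplicity of the upper part times the number of lower columns of the same degree as \<open>b\<close>. The
  quotient therefore depends on \<open>b\<close> only.

  The row span condition comes from homogeneity. An ideal generated by differences of monomials
  vanishes at \<open>(1, \<dots>, 1)\<close> and so contains no monomial; hence a binomial in a homogeneous toric ideal
  is itself homogeneous. This means that every integer vector in the kernel of the matrix is
  annihilated by the degree functional of each floret, and by linear algebra over the rationals this
  functional is a combination of rows.\<close>

section \<open>Linear algebra\<close>

text \<open>Induction on the number of functionals. A new functional either vanishes on the common
  zeros of the old ones and gets coefficient 0, or it is nonzero at one of these zeros,
  \<open>v\<close>; then \<open>g\<close> and the test vectors can be corrected along
  \<open>f k\<close> and \<open>v\<close> respectively.\<close>

lemma combination_if_common_zeros:
  fixes f :: "'i \<Rightarrow> 'x \<Rightarrow> 'a::field"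
  assumes "finite I" "finite X"
    and "\<And>u. (\<forall>i\<in>I. (\<Sum>x\<in>X. f i x * u x) = 0) \<Longrightarrow> (\<Sum>x\<in>X. g x * u x) = 0"
  shows "\<exists>c. \<forall>x\<in>X. g x = (\<Sum>i\<in>I. c i * f i x)"
  using assms(1,3)
proof (induction I arbitrary: g rule: finite_induct)
  case empty
  \<comment> \<open>Every vector is a common zero of the empty family, in particular the unit vector
    at \<open>x\<close>.\<close>
  have "g x = 0" if "x \<in> X" for x
    using empty[of "\<lambda>y. if y = x then 1 else 0"] that \<open>finite X\<close>
    by (simp add: if_distrib cong: if_cong)
  then show ?case by simp
next
  case (insert k I)
  show ?case
  proof (cases "\<forall>u. (\<forall>i\<in>I. (\<Sum>x\<in>X. f i x * u x) = 0) \<longrightarrow> (\<Sum>x\<in>X. f k x * u x) = 0")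
    case True
    then have "\<exists>c. \<forall>x\<in>X. g x = (\<Sum>i\<in>I. c i * f i x)"
      using insert.prems by (intro insert.IH) auto
    then obtain c where c: "\<forall>x\<in>X. g x = (\<Sum>i\<in>I. c i * f i x)" ..
    have "(\<Sum>i\<in>I. (c(k := 0)) i * f i x) = (\<Sum>i\<in>I. c i * f i x)" for x
      using insert.hyps by (intro sum.cong) auto
    then show ?thesis
      using c insert.hyps by (intro exI[of _ "c(k := 0)"]) auto
  next
    case False
    then obtain v where v: "\<forall>i\<in>I. (\<Sum>x\<in>X. f i x * v x) = 0" "(\<Sum>x\<in>X. f k x * v x) \<noteq> 0"
      by blast
    \<comment> \<open>With this coefficient, \<open>g\<close> minus \<open>r\<close> times
      \<open>f k\<close> vanishes at \<open>v\<close>.\<close>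
    define r where "r = (\<Sum>x\<in>X. g x * v x) / (\<Sum>x\<in>X. f k x * v x)"
    have "\<exists>c. \<forall>x\<in>X. g x - r * f k x = (\<Sum>i\<in>I. c i * f i x)"
    proof (rule insert.IH)
      fix u assume u: "\<forall>i\<in>I. (\<Sum>x\<in>X. f i x * u x) = 0"
      \<comment> \<open>Subtracting \<open>s\<close> times \<open>v\<close> from \<open>u\<close>
        makes \<open>f k\<close> vanish too and preserves the zeros of the other functionals, so the
        hypothesis on \<open>g\<close> applies to the difference.\<close>
      define s where "s = (\<Sum>x\<in>X. f k x * u x) / (\<Sum>x\<in>X. f k x * v x)"
      have lin: "(\<Sum>x\<in>X. h x * (u x - s * v x)) = (\<Sum>x\<in>X. h x * u x) - s * (\<Sum>x\<in>X. h x * v x)"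
        for h
        by (simp add: algebra_simps sum_subtractf sum_distrib_left)
      have "(\<Sum>x\<in>X. g x * (u x - s * v x)) = 0"
      proof (rule insert.prems, rule ballI)
        fix i assume "i \<in> insert k I"
        then show "(\<Sum>x\<in>X. f i x * (u x - s * v x)) = 0"
          unfolding lin using u v by (auto simp: s_def)
      qed
      then have "(\<Sum>x\<in>X. g x * u x) = s * (\<Sum>x\<in>X. g x * v x)"
        unfolding lin by simp
      moreover have "(\<Sum>x\<in>X. (g x - r * f k x) * u x)
          = (\<Sum>x\<in>X. g x * u x) - r * (\<Sum>x\<in>X. f k x * u x)"
        by (simp add: algebra_simps sum_subtractf sum_distrib_left)
      ultimately show "(\<Sum>x\<in>X. (g x - r * f k x) * u x) = 0"
        by (simp add: r_def s_def)
    qed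
    then obtain c where c: "\<forall>x\<in>X. g x - r * f k x = (\<Sum>i\<in>I. c i * f i x)" ..
    have "(\<Sum>i\<in>I. (c(k := r)) i * f i x) = (\<Sum>i\<in>I. c i * f i x)" for x
      using insert.hyps by (intro sum.cong) auto
    then show ?thesis
      using c insert.hyps by (intro exI[of _ "c(k := r)"]) (auto simp: algebra_simps)
  qed
qed

lemma common_denominator:
  fixes u :: "'x \<Rightarrow> rat"
  assumes "finite X"
  shows "\<exists>N w. N \<noteq> 0 \<and> (\<forall>x\<in>X. of_int N * u x = of_int (w x))"
  using assms
proof (induction X rule: finite_induct)
  case empty
  show ?case by (auto intro: exI[of _ 1])
next
  case (insert y X)
  then obtain N w where N: "N \<noteq> 0" "\<forall>x\<in>X. of_int N * u x = of_int (w x)" by blast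
  obtain p q where pq: "u y = of_int p / of_int q" "q \<noteq> 0"
    by (metis Fract_of_int_quotient quotient_of_denom_pos' quotient_of_div prod.collapse less_irrefl)
  show ?case
  proof (intro exI conjI ballI)
    show "N * q \<noteq> 0" using N pq by simp
    fix x assume "x \<in> insert y X"
    then show "of_int (N * q) * u x = of_int (if x = y then N * p else q * w x)"
      using N pq by (auto simp: algebra_simps)
  qed
qed

text \<open>Binomials give information on integer vectors only. A rational vector in the kernel
  becomes integral after multiplication by a common denominator, so the criterion over the field of
  rationals applies.\<close>

lemma combination_if_integer_kernel:
  fixes f :: "'i \<Rightarrow> 'x \<Rightarrow> int" and g :: "'x \<Rightarrow> int"
  assumes "finite I" "finite X"
    and ker: "\<And>w :: 'x \<Rightarrow> int. (\<forall>i\<in>I. (\<Sum>x\<in>X. f i x * w x) = 0) \<Longrightarrow> (\<Sum>x\<in>X. g x * w x) = 0"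
  shows "\<exists>c :: 'i \<Rightarrow> rat. \<forall>x\<in>X. of_int (g x) = (\<Sum>i\<in>I. c i * of_int (f i x))"
proof (rule combination_if_common_zeros[OF assms(1,2)])
  fix u :: "'x \<Rightarrow> rat"
  assume u: "\<forall>i\<in>I. (\<Sum>x\<in>X. of_int (f i x) * u x) = 0"
  obtain N w where N: "N \<noteq> 0" "\<forall>x\<in>X. of_int N * u x = of_int (w x)"
    using common_denominator[OF assms(2)] by blast
  have scale: "of_int (\<Sum>x\<in>X. h x * w x) = of_int N * (\<Sum>x\<in>X. of_int (h x) * u x)" for h
  proof -
    have "of_int (h x) * of_int (w x) = of_int N * (of_int (h x) * u x)" if "x \<in> X" for x
      using N that by (metis mult.left_commute)
    then show ?thesis unfolding of_int_sum of_int_mult sum_distrib_left by (rule sum.cong[OF refl])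
  qed
  have "(\<Sum>x\<in>X. f i x * w x) = 0" if "i \<in> I" for i
    using scale[of "f i"] u that by (simp only: mult_zero_right of_int_eq_0_iff)
  then have "(\<Sum>x\<in>X. g x * w x) = 0" by (intro ker) blast
  with scale[of g] N show "(\<Sum>x\<in>X. of_int (g x) * u x) = 0" by simp
qed

section \<open>Homogeneous toric ideals\<close>

text \<open>This is evaluation at the point all of whose coordinates are 1, where every monomial has
  the value 1.\<close>

definition coeff_sum :: "'x cpoly \<Rightarrow> complex" where
  "coeff_sum f = Sum_any (Poly_Mapping.lookup f)"

lemma coeff_sum_simps [simp]:
  "coeff_sum 0 = 0"
  "coeff_sum (f + g) = coeff_sum f + coeff_sum g"
  "coeff_sum (Poly_Mapping.single a c) = c"
proof -
  show "coeff_sum 0 = 0" by (simp add: coeff_sum_def)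
  show "coeff_sum (f + g) = coeff_sum f + coeff_sum g"
    unfolding coeff_sum_def by (simp add: lookup_add Sum_any.distrib)
  show "coeff_sum (Poly_Mapping.single a c) = c"
    unfolding coeff_sum_def by (simp add: lookup_single)
qed

lemma coeff_sum_sum: "coeff_sum (\<Sum>i\<in>I. h i) = (\<Sum>i\<in>I. coeff_sum (h i))"
  by (induction I rule: infinite_finite_induct) simp_all

lemma coeff_sum_minus [simp]: "coeff_sum (f - g) = coeff_sum f - coeff_sum g"
  using coeff_sum_simps(2)[of "f - g" g] by (simp add: algebra_simps)

lemma coeff_sum_uminus [simp]: "coeff_sum (- f) = - coeff_sum f"
  using coeff_sum_minus[of 0 f] by simp

lemma coeff_sum_mult: "coeff_sum (f * g) = coeff_sum f * coeff_sum g"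
proof -
  define mono where "mono h a = Poly_Mapping.single a (Poly_Mapping.lookup h a)"
    for h :: "'a cpoly" and a
  \<comment> \<open>Expanding both factors into monomials reduces multiplicativity to products of
    two monomials.\<close>
  have dec: "h = (\<Sum>a\<in>Poly_Mapping.keys h. mono h a)" for h
    by (rule poly_mapping_eqI)
      (auto simp: mono_def lookup_sum lookup_single when_def in_keys_iff)
  have "f * g = (\<Sum>a\<in>Poly_Mapping.keys f. \<Sum>b\<in>Poly_Mapping.keys g. mono f a * mono g b)"
    by (subst dec[of f], subst dec[of g]) (simp add: sum_product)
  also have "coeff_sum \<dots> = (\<Sum>a\<in>Poly_Mapping.keys f. coeff_sum (mono f a)) *
      (\<Sum>b\<in>Poly_Mapping.keys g. coeff_sum (mono g b))"
    by (simp add: coeff_sum_sum sum_product mono_def mult_single)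
  also have "\<dots> = coeff_sum f * coeff_sum g"
    by (simp only: coeff_sum_sum[symmetric] dec[symmetric])
  finally show ?thesis .
qed

text \<open>Evaluation is multiplicative, so its kernel \<open>?K\<close> is an ideal of the
  polynomial ring. It contains all the generating binomials and hence the ideal they generate, an
  intersection over all such ideals.\<close>

lemma coeff_sum_toric_ideal:
  assumes "f \<in> toric_ideal M"
  shows "coeff_sum f = 0"
proof -
  let ?R = "poly_ring {..<dim_col M}"
  interpret R: cring ?R by (rule cring_poly_ring)
  let ?K = "{f \<in> carrier ?R. coeff_sum f = 0}"
  \<comment> \<open>The abstract additive inverse of \<open>poly_ring\<close> is identified with
    ordinary negation, for which \<open>coeff_sum\<close> is known.\<close>
  have inv: "\<ominus>\<^bsub>?R\<^esub> f = - f" if "f \<in> carrier ?R" for f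
    using that by (intro R.minus_equality) (auto simp: poly_ring_carrier poly_ring_simps)
  have "ideal ?K ?R"
  proof (rule idealI[OF R.ring_axioms])
    show "subgroup ?K (add_monoid ?R)"
    proof (rule R.add.subgroupI)
      show "?K \<noteq> {}" using R.zero_closed by (auto simp: poly_ring_simps)
      show "\<ominus>\<^bsub>?R\<^esub> f \<in> ?K" if "f \<in> ?K" for f
        using that R.a_inv_closed[of f] inv[of f] by auto
      show "f \<oplus>\<^bsub>?R\<^esub> g \<in> ?K" if "f \<in> ?K" "g \<in> ?K" for f g
        using that R.a_closed[of f g] by (auto simp: poly_ring_simps)
    qed auto
    show "x \<otimes>\<^bsub>?R\<^esub> f \<in> ?K" "f \<otimes>\<^bsub>?R\<^esub> x \<in> ?K" if "f \<in> ?K" "x \<in> carrier ?R" for f x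
      using that R.m_closed[of f x] R.m_closed[of x f] by (auto simp: poly_ring_simps coeff_sum_mult)
  qed
  moreover have "Poly_Mapping.single a 1 - Poly_Mapping.single b 1 \<in> ?K"
    if "Poly_Mapping.keys a \<subseteq> {..<dim_col M}" "Poly_Mapping.keys b \<subseteq> {..<dim_col M}" for a b
  proof -
    have "\<forall>c\<in>Poly_Mapping.keys (Poly_Mapping.single a (1 :: complex) - Poly_Mapping.single b 1).
        c = a \<or> c = b"
      by (auto simp: in_keys_iff lookup_minus lookup_single when_def split: if_splits)
    moreover have "coeff_sum (Poly_Mapping.single a 1 - Poly_Mapping.single b 1) = 0"
      by simp
    ultimately show ?thesis using that by (auto simp: poly_ring_carrier)
  qed
  ultimately have "toric_ideal M \<subseteq> ?K"
    unfolding toric_ideal_def genideal_def by auto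
  with assms show ?thesis by blast
qed

text \<open>If the degrees differed, the component of the binomial in the degree of \<open>a\<close>
  would be a single monomial. Homogeneity would put it into the ideal, but its coefficient sum is
  1.\<close>

lemma homogeneous_toric_ideal_multidegree:
  assumes "homogeneous_ideal deg (toric_ideal M)"
    and "Poly_Mapping.keys a \<subseteq> {..<dim_col M}" "Poly_Mapping.keys b \<subseteq> {..<dim_col M}"
    and "M *\<^sub>v vec (dim_col M) (Poly_Mapping.lookup a) = M *\<^sub>v vec (dim_col M) (Poly_Mapping.lookup b)"
  shows "multidegree deg a = multidegree deg b"
proof (rule ccontr)
  assume ne: "multidegree deg a \<noteq> multidegree deg b"
  let ?f = "Poly_Mapping.single a (1 :: complex) - Poly_Mapping.single b 1"
  have "?f \<in> toric_ideal M"
    unfolding toric_ideal_def genideal_def using assms(2-4) by blast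
  then have "coeff_sum (homogeneous_component deg (multidegree deg a) ?f) = 0"
    using assms(1) by (auto simp: homogeneous_ideal_def intro: coeff_sum_toric_ideal)
  moreover have "{c \<in> Poly_Mapping.keys ?f. multidegree deg c = multidegree deg a} = {a}"
    using ne by (auto simp: in_keys_iff lookup_minus lookup_single when_def split: if_splits)
  then have "homogeneous_component deg (multidegree deg a) ?f = Poly_Mapping.single a 1"
    using ne by (auto simp: homogeneous_component_def lookup_minus lookup_single when_def)
  ultimately show False by simp
qed

lemma multidegree_eq_sum:
  assumes "finite X" "Poly_Mapping.keys a \<subseteq> X"
  shows "multidegree deg a r = (\<Sum>x\<in>X. int (Poly_Mapping.lookup a x) * deg x r)"
  unfolding multidegree_def
  using assms by (intro sum.mono_neutral_left) (auto simp: in_keys_iff)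

text \<open>An integer vector in the kernel of \<open>M\<close> is the difference of two exponent
  vectors with the same image under \<open>M\<close>, hence of the same degree. So the coordinate
  \<open>r\<close> of the degree annihilates the integer kernel.\<close>

lemma degree_combination_of_rows:
  fixes M :: "nat mat" and deg :: "nat \<Rightarrow> 'r \<Rightarrow> int"
  assumes "homogeneous_ideal deg (toric_ideal M)"
  shows "\<exists>c :: nat \<Rightarrow> rat. \<forall>x<dim_col M.
    of_int (deg x r) = (\<Sum>i<dim_row M. c i * of_nat (M $$ (i, x)))"
proof -
  let ?n = "dim_col M"
  have "\<exists>c :: nat \<Rightarrow> rat. \<forall>x\<in>{..<?n}.
    of_int (deg x r) = (\<Sum>i\<in>{..<dim_row M}. c i * of_int (int (M $$ (i, x))))"
  proof (rule combination_if_integer_kernel)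
    fix w :: "nat \<Rightarrow> int"
    assume w: "\<forall>i\<in>{..<dim_row M}. (\<Sum>x\<in>{..<?n}. int (M $$ (i, x)) * w x) = 0"
    \<comment> \<open>Since \<open>nat\<close> truncates negative integers to 0, applying
      \<open>pm\<close> to \<open>w\<close> and to its negative yields the positive and the negative
      part of \<open>w\<close>.\<close>
    define pm where "pm h = Abs_poly_mapping (\<lambda>x. if x < ?n then nat (h x) else 0)"
      for h :: "nat \<Rightarrow> int"
    have "finite {x. (if x < ?n then nat (h x) else 0) \<noteq> 0}" for h
      by (rule finite_subset[of _ "{..<?n}"]) auto
    then have pm: "Poly_Mapping.lookup (pm h) x = (if x < ?n then nat (h x) else 0)" for h x
      by (simp add: pm_def)
    have keys: "Poly_Mapping.keys (pm h) \<subseteq> {..<?n}" for h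
      by (auto simp: in_keys_iff pm split: if_splits)
    let ?a = "pm w" and ?b = "pm (\<lambda>x. - w x)"
    have diff: "int (Poly_Mapping.lookup ?a x) - int (Poly_Mapping.lookup ?b x) = w x"
      if "x < ?n" for x
      using that by (simp add: pm)
    have mv: "M *\<^sub>v vec ?n (Poly_Mapping.lookup p)
        = vec (dim_row M) (\<lambda>i. \<Sum>x<?n. M $$ (i, x) * Poly_Mapping.lookup p x)" for p
      by (intro eq_vecI) (auto simp: scalar_prod_def atLeast0LessThan)
    have "(\<Sum>x<?n. M $$ (i, x) * Poly_Mapping.lookup ?a x)
        = (\<Sum>x<?n. M $$ (i, x) * Poly_Mapping.lookup ?b x)" if "i < dim_row M" for i
    proof -
      have "int (\<Sum>x<?n. M $$ (i, x) * Poly_Mapping.lookup ?a x)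
          - int (\<Sum>x<?n. M $$ (i, x) * Poly_Mapping.lookup ?b x)
          = (\<Sum>x<?n. int (M $$ (i, x)) *
              (int (Poly_Mapping.lookup ?a x) - int (Poly_Mapping.lookup ?b x)))"
        by (simp add: sum_subtractf right_diff_distrib)
      also have "\<dots> = (\<Sum>x<?n. int (M $$ (i, x)) * w x)"
        by (rule sum.cong) (simp_all add: diff)
      also have "\<dots> = 0" using w that by simp
      finally show ?thesis by linarith
    qed
    then have "multidegree deg ?a = multidegree deg ?b"
      by (intro homogeneous_toric_ideal_multidegree[OF assms] keys) (auto simp: mv)
    then have "0 = multidegree deg ?a r - multidegree deg ?b r" by simp
    also have "\<dots> = (\<Sum>x<?n. deg x r *
        (int (Poly_Mapping.lookup ?a x) - int (Poly_Mapping.lookup ?b x)))"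
      by (simp add: multidegree_eq_sum[OF _ keys] sum_subtractf right_diff_distrib mult.commute)
    also have "\<dots> = (\<Sum>x<?n. deg x r * w x)"
      by (rule sum.cong) (simp_all add: diff)
    finally show "(\<Sum>x\<in>{..<?n}. deg x r * w x) = 0" by simp
  qed simp_all
  then show ?thesis by (simp only: of_int_of_nat_eq lessThan_iff Ball_def)
qed

section \<open>Column multiplicities\<close>

text \<open>Here \<open>Z\<close> stands for the columns of the product, and \<open>a\<close>,
  \<open>b\<close> give the upper and lower part of a column. Degrees depend on the value of a
  column and not on its position, so all copies of a column have the same partners and the sets to
  be counted are Cartesian products.\<close>

lemma fiber_product_column_ratio:
  fixes \<sigma> :: "'x \<times> 'y \<Rightarrow> 'z" and a :: "'z \<Rightarrow> 'a" and b :: "'z \<Rightarrow> 'b"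
    and p :: "'x \<Rightarrow> 'a" and q :: "'y \<Rightarrow> 'b" and g :: "'a \<Rightarrow> 'i" and h :: "'b \<Rightarrow> 'i"
    and X :: "'x set" and Y :: "'y set"
  defines "P \<equiv> tfp_vars X (\<lambda>x. g (p x)) Y (\<lambda>y. h (q y))"
  assumes "finite X" "finite Y" and \<sigma>: "bij_betw \<sigma> P Z"
    and a: "\<And>x y. (x, y) \<in> P \<Longrightarrow> a (\<sigma> (x, y)) = p x"
    and b: "\<And>x y. (x, y) \<in> P \<Longrightarrow> b (\<sigma> (x, y)) = q y"
    and "j \<in> Z" "j' \<in> Z" "b j = b j'"
  shows "real (card {i\<in>Z. a i = a j \<and> b i = b j}) / real (card {i\<in>Z. a i = a j}) =
    real (card {i\<in>Z. a i = a j' \<and> b i = b j'}) / real (card {i\<in>Z. a i = a j'})"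
proof -
  \<comment> \<open>The right-hand side depends on \<open>j\<close> through \<open>b j\<close>
    only.\<close>
  have "real (card {i\<in>Z. a i = a j \<and> b i = b j}) / real (card {i\<in>Z. a i = a j}) =
    real (card {y\<in>Y. q y = b j}) / real (card {y\<in>Y. h (q y) = h (b j)})" if j: "j \<in> Z" for j
  proof -
    obtain x0 y0 where xy: "(x0, y0) \<in> P" "\<sigma> (x0, y0) = j"
      using \<sigma> j unfolding bij_betw_def by force
    then have ab: "p x0 = a j" "q y0 = b j" "x0 \<in> X" "g (a j) = h (b j)"
      using a b by (auto simp: P_def tfp_vars_def)
    \<comment> \<open>Counts in \<open>Z\<close> are moved to pairs along
      \<open>\<sigma>\<close>.\<close>
    have card_eq: "card {i\<in>Z. Q (a i) (b i)} = card {(x, y)\<in>P. Q (p x) (q y)}" for Q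
    proof -
      have "bij_betw \<sigma> {(x, y)\<in>P. Q (p x) (q y)} {i\<in>Z. Q (a i) (b i)}"
        using \<sigma> a b unfolding bij_betw_def inj_on_def by (auto simp: image_iff)
      then show ?thesis by (simp add: bij_betw_same_card)
    qed
    \<comment> \<open>The degree condition in \<open>P\<close> holds automatically for these pairs,
      because \<open>g (a j) = h (b j)\<close>.\<close>
    have "{(x, y)\<in>P. p x = a j \<and> q y = b j} = {x\<in>X. p x = a j} \<times> {y\<in>Y. q y = b j}"
      using ab by (auto simp: P_def tfp_vars_def)
    then have c1: "card {i\<in>Z. a i = a j \<and> b i = b j}
        = card {x\<in>X. p x = a j} * card {y\<in>Y. q y = b j}"
      using card_eq[of "\<lambda>u v. u = a j \<and> v = b j"] by (simp add: card_cartesian_product)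
    have "{(x, y)\<in>P. p x = a j} = {x\<in>X. p x = a j} \<times> {y\<in>Y. h (q y) = h (b j)}"
      using ab by (auto simp: P_def tfp_vars_def)
    then have c2: "card {i\<in>Z. a i = a j}
        = card {x\<in>X. p x = a j} * card {y\<in>Y. h (q y) = h (b j)}"
      using card_eq[of "\<lambda>u v. u = a j"] by (simp add: card_cartesian_product)
    \<comment> \<open>The witness \<open>x0\<close> makes this multiplicity nonzero, so it cancels
      from the quotient.\<close>
    have "card {x\<in>X. p x = a j} \<noteq> 0" using ab \<open>finite X\<close> by auto
    then show ?thesis unfolding c1 c2 by simp
  qed
  from this[of j] this[of j'] show ?thesis using assms by simp
qed

section \<open>Stacked matrices and florets\<close>

lemma stack_carrier:
  assumes "\<forall>B\<in>set Bs. dim_col B = m"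
  shows "dim_col (stack m Bs) = m"
    and "dim_row (stack m Bs) = sum_list (map dim_row Bs)"
  using assms by (induction Bs) (auto simp: stack_def append_rows_def)

lemma col_append_rows:
  assumes "dim_col A = m" "dim_col B = m" "j < m"
  shows "col (A @\<^sub>r B) j = col A j @\<^sub>v col B j"
  using assms by (intro eq_vecI) (auto simp: append_rows_def)

lemma col_stack_snoc:
  assumes "\<forall>B\<in>set Bs. dim_col B = m" "dim_col C = m" "j < m"
  shows "col (stack m (Bs @ [C])) j = col (stack m Bs) j @\<^sub>v col C j"
  using assms(1)
proof (induction Bs)
  case Nil
  show ?case
    using assms by (intro eq_vecI) (auto simp: stack_def append_rows_def)
next
  case (Cons B Bs)
  have "stack m (B # Bs @ [C]) = B @\<^sub>r stack m (Bs @ [C])" "stack m (B # Bs) = B @\<^sub>r stack m Bs"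
    by (simp_all add: stack_def)
  moreover have "(u @\<^sub>v v) @\<^sub>v w = u @\<^sub>v (v @\<^sub>v w)" for u v w :: "nat vec"
    by (intro eq_vecI) auto
  moreover have "dim_col (stack m (Bs @ [C])) = m" "dim_col (stack m Bs) = m"
    using Cons.prems assms by (auto intro!: stack_carrier)
  ultimately show ?case
    using Cons assms by (simp add: col_append_rows)
qed

lemma append_vec_eq_iff:
  assumes "dim_vec u = dim_vec u'"
  shows "u @\<^sub>v v = u' @\<^sub>v v' \<longleftrightarrow> u = u' \<and> v = v'"
  by (rule append_vec_eq[OF carrier_vecI[OF refl] carrier_vecI[OF assms[symmetric]]])

lemma partition_matrixD:
  assumes "partition_matrix m C"
  shows "dim_col C = m" "elements_mat C \<subseteq> {0, 1}"
    "\<forall>j<m. \<exists>!i. i < dim_row C \<and> C $$ (i, j) = 1"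
proof -
  note C = assms[unfolded partition_matrix_def]
  show "dim_col C = m" by (rule C[THEN conjunct1])
  show "elements_mat C \<subseteq> {0, 1}" by (rule C[THEN conjunct2, THEN conjunct1])
  show "\<forall>j<m. \<exists>!i. i < dim_row C \<and> C $$ (i, j) = 1"
    by (rule C[THEN conjunct2, THEN conjunct2, THEN conjunct1])
qed

lemma partition_matrix_entry:
  assumes "partition_matrix m C" "v < dim_row C" "j < m"
  shows "C $$ (v, j) = 0 \<or> C $$ (v, j) = 1"
proof -
  have "C $$ (v, j) \<in> elements_mat C"
    by (rule elements_matI[OF carrier_matI[OF refl partition_matrixD(1)[OF assms(1)]] assms(2,3) refl])
  then have "C $$ (v, j) \<in> {0, 1}" using partition_matrixD(2)[OF assms(1)] by (rule rev_subsetD)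
  then show ?thesis by simp
qed

lemma partition_matrix_col:
  assumes "partition_matrix m C" "j < m"
  obtains v where "v < dim_row C" "j \<in> row_support C v" "col C j = unit_vec (dim_row C) v"
    "\<And>v'. v' < dim_row C \<Longrightarrow> j \<in> row_support C v' \<Longrightarrow> v' = v"
proof -
  have m: "dim_col C = m" using assms(1) by (rule partition_matrixD)
  have "\<exists>!i. i < dim_row C \<and> C $$ (i, j) = 1"
    by (rule partition_matrixD(3)[OF assms(1), rule_format, OF assms(2)])
  then obtain v where v: "v < dim_row C" "C $$ (v, j) = 1"
    and uniq: "\<forall>v'. v' < dim_row C \<and> C $$ (v', j) = 1 \<longrightarrow> v' = v"
    by (elim ex1E conjE)
  have entry: "C $$ (i, j) = (if i = v then 1 else 0)" if "i < dim_row C" for i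
    using v uniq that partition_matrix_entry[OF assms(1) that assms(2)] by metis
  show thesis
  proof
    show "j \<in> row_support C v" using v(2) m assms(2) by (simp add: row_support_def)
    show "col C j = unit_vec (dim_row C) v"
    proof (rule eq_vecI)
      fix i assume "i < dim_vec (unit_vec (dim_row C) v)"
      then have i: "i < dim_row C" by simp
      then have "col C j $ i = C $$ (i, j)"
        using m assms(2) by (intro index_col) simp_all
      also have "\<dots> = unit_vec (dim_row C) v $ i"
        using entry[OF i] i v(1) by simp
      finally show "col C j $ i = unit_vec (dim_row C) v $ i" .
    qed simp
    show "v' = v" if v': "v' < dim_row C" "j \<in> row_support C v'" for v'
    proof (rule ccontr)
      assume "v' \<noteq> v"
      then show False using v'(2) entry[OF v'(1)] by (simp add: row_support_def)
    qed
  qed (rule v(1))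
qed

text \<open>Well-connectedness compares columns in the support of one row. They are the same unit
  vector, and equality of columns is what the counting argument takes as input.\<close>

lemma partition_matrix_same_row:
  assumes "partition_matrix m C" "u < dim_row C" "j \<in> row_support C u" "j' \<in> row_support C u"
  shows "j < m" "j' < m" "col C j = col C j'"
proof -
  show j: "j < m" "j' < m"
    using assms(3,4) partition_matrixD(1)[OF assms(1)] by (simp_all add: row_support_def)
  have "col C i = unit_vec (dim_row C) u" if i: "i < m" "i \<in> row_support C u" for i
  proof -
    obtain v where v: "col C i = unit_vec (dim_row C) v"
      "\<And>v'. v' < dim_row C \<Longrightarrow> i \<in> row_support C v' \<Longrightarrow> v' = v"
      by (rule partition_matrix_col[OF assms(1) i(1)]) blast
    from v(2)[OF assms(2) i(2)] v(1) show ?thesis by simp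
  qed
  then show "col C j = col C j'" using j assms(3,4) by simp
qed

section \<open>Column labels, the cup matrix and floret degrees\<close>

lemma col_label_less:
  assumes "j < dim_col A"
  shows "col_label A j < num_distinct_cols A"
  using col_label_spec[of A] assms by blast

lemma col_label_eq_iff:
  assumes "j < dim_col A" "j' < dim_col A"
  shows "col_label A j = col_label A j' \<longleftrightarrow> col A j = col A j'"
  using col_label_spec[of A] assms by blast

lemma cup_matrix_dims [simp]:
  "dim_row (cup_matrix A) = num_distinct_cols A" "dim_col (cup_matrix A) = dim_col A"
  by (simp_all add: cup_matrix_def)

lemma row_support_cup_matrix:
  assumes "u < num_distinct_cols A"
  shows "row_support (cup_matrix A) u = {j. j < dim_col A \<and> col_label A j = u}"
  using assms by (auto simp: row_support_def cup_matrix_def split: if_splits)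

text \<open>The columns of the cup matrix are the unit vectors of the labels. Column counts are
  therefore the same for \<open>A\<close> and for its cup matrix.\<close>

lemma col_cup_matrix_eq_iff:
  assumes "j < dim_col A" "j' < dim_col A"
  shows "col (cup_matrix A) j = col (cup_matrix A) j' \<longleftrightarrow> col A j = col A j'"
proof -
  have "col (cup_matrix A) i = unit_vec (num_distinct_cols A) (col_label A i)"
    if "i < dim_col A" for i
    using that by (intro eq_vecI) (auto simp: cup_matrix_def unit_vec_def)
  moreover have "unit_vec n u = (unit_vec n v :: nat vec) \<longleftrightarrow> u = v" if "u < n" "v < n" for n u v
    using arg_cong[of "unit_vec n u" "unit_vec n v :: nat vec" "\<lambda>w. w $ u"] that
    by (auto split: if_splits)
  ultimately show ?thesis
    using assms by (simp add: col_label_less col_label_eq_iff)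
qed

text \<open>The index is defined through the upper rows, the cap matrix through the lower ones.
  Column \<open>j\<close> links the two: the row of \<open>cup_matrix A\<close> and the row of
  \<open>C\<close> that contain \<open>j\<close> are connected, so they belong to the same
  floret.\<close>

lemma upper_floret_index_eq_iff:
  assumes "partition_matrix m C" "dim_col A = m" "floret_condition (cup_matrix A) C"
    and "j < m" "t < length (florets (cup_matrix A) C)"
  shows "upper_floret_index A C (col A j) = t \<longleftrightarrow> cap_matrix (cup_matrix A) C $$ (t, j) = 1"
proof -
  let ?B = "cup_matrix A" and ?u = "col_label A j"
  let ?F = "florets ?B C"
  have F: "distinct ?F" "set ?F = connected_rows ?B C ` {..<dim_row ?B}"
    using florets_spec[of ?B C] by auto
  have u: "?u < dim_row ?B" using assms col_label_less by simp
  obtain v where v: "v < dim_row C" "j \<in> row_support C v"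
    "\<And>v'. v' < dim_row C \<Longrightarrow> j \<in> row_support C v' \<Longrightarrow> v' = v"
    by (rule partition_matrix_col[OF assms(1,4)]) blast
  have m: "dim_col C = m" using assms(1) by (rule partition_matrixD)
  have vu: "v \<in> connected_rows ?B C ?u"
  proof -
    have "j \<in> row_support ?B ?u"
      using u assms(2,4) by (simp add: row_support_cup_matrix)
    with v(1,2) show ?thesis by (auto simp only: connected_rows_def)
  qed
  \<comment> \<open>The floret condition turns a nonempty intersection into equality, and
    \<open>v\<close> shows that a floret equal to this set does meet it.\<close>
  have meets: "connected_rows ?B C ?u \<inter> ?F ! s \<noteq> {} \<longleftrightarrow> ?F ! s = connected_rows ?B C ?u"
    if s: "s < length ?F" for s
  proof -
    obtain u' where u': "u' < dim_row ?B" "?F ! s = connected_rows ?B C u'"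
      using nth_mem[OF s] unfolding F(2) by blast
    have "connected_rows ?B C ?u \<inter> connected_rows ?B C u' = {}
        \<or> connected_rows ?B C ?u = connected_rows ?B C u'"
      using assms(3) u u'(1) unfolding floret_condition_def by blast
    then show ?thesis unfolding u'(2) using vu by blast
  qed
  \<comment> \<open>The index quantifies over all columns equal to the given one; these share a
    single label, so one label decides.\<close>
  have in_upper: "(\<exists>j'<dim_col A. col A j' = col A j \<and> col_label A j' \<in> upper_floret ?B C s)
      \<longleftrightarrow> ?F ! s = connected_rows ?B C ?u" if "s < length ?F" for s
  proof -
    have "col_label A j' = ?u" if "j' < dim_col A" "col A j' = col A j" for j'
      using col_label_eq_iff[OF that(1), of j] that(2) assms(2,4) by simp
    then have "(\<exists>j'<dim_col A. col A j' = col A j \<and> col_label A j' \<in> upper_floret ?B C s)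
        \<longleftrightarrow> ?u \<in> upper_floret ?B C s"
      using assms(2,4) by metis
    also have "\<dots> \<longleftrightarrow> connected_rows ?B C ?u \<inter> ?F ! s \<noteq> {}"
      using u by (simp add: upper_floret_def)
    finally show ?thesis using meets[OF that] by simp
  qed
  obtain t0 where t0: "t0 < length ?F" "?F ! t0 = connected_rows ?B C ?u"
  proof -
    have "connected_rows ?B C ?u \<in> set ?F" unfolding F(2) using u by blast
    then show thesis using that unfolding in_set_conv_nth by blast
  qed
  have uniq: "?F ! s = connected_rows ?B C ?u \<longleftrightarrow> s = t0" if "s < length ?F" for s
    unfolding t0(2)[symmetric] by (rule nth_eq_iff_index_eq[OF F(1) that t0(1)])
  have "upper_floret_index A C (col A j) = t0"
    unfolding upper_floret_index_def
  proof (rule the_equality)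
    show "t0 < length ?F \<and>
        (\<exists>j'<dim_col A. col A j' = col A j \<and> col_label A j' \<in> upper_floret ?B C t0)"
      using t0 in_upper[OF t0(1)] by blast
    show "s = t0" if "s < length ?F \<and>
        (\<exists>j'<dim_col A. col A j' = col A j \<and> col_label A j' \<in> upper_floret ?B C s)" for s
      using that in_upper uniq by blast
  qed
  \<comment> \<open>Members of a floret are row indices of \<open>C\<close>, and \<open>v\<close> is
    the only such row with \<open>j\<close> in its support.\<close>
  moreover have "cap_matrix ?B C $$ (t, j) = 1 \<longleftrightarrow> v \<in> ?F ! t"
  proof -
    have "?F ! t \<in> connected_rows ?B C ` {..<dim_row ?B}"
      using nth_mem[OF assms(5)] F(2) by simp
    then obtain u' where "?F ! t = connected_rows ?B C u'" by blast
    then have "\<forall>v'\<in>?F ! t. v' < dim_row C"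
      by (simp add: connected_rows_def)
    then have "(\<exists>v'\<in>?F ! t. j \<in> row_support C v') \<longleftrightarrow> v \<in> ?F ! t"
      using v by blast
    then show ?thesis using assms(4,5) m by (simp add: cap_matrix_def)
  qed
  moreover have "v \<in> ?F ! t \<longleftrightarrow> t = t0"
    using meets[OF assms(5)] uniq[OF assms(5)] vu by blast
  ultimately show ?thesis by (simp only: eq_commute)
qed

text \<open>Row \<open>t\<close> of the cap matrix lists the coordinate \<open>t\<close> of the
  degrees of the columns of \<open>A\<close>. On the columns of \<open>At\<close> this coordinate is
  a combination of rows, and the same coefficients serve for \<open>A\<close>.\<close>

lemma cap_matrix_rows_in_row_space:
  assumes C: "partition_matrix m C" and A: "dim_col A = m"
    and fl: "floret_condition (cup_matrix A) C" and At: "compression At A"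
    and hom: "homogeneous_ideal (\<lambda>x s. if s = upper_floret_index A C (col At x) then 1 else 0)
      (toric_ideal At)"
  shows "set (rows (map_mat real (cap_matrix (cup_matrix A) C)))
    \<subseteq> vec_space.row_space m (map_mat real A)"
proof
  interpret vec_space "TYPE(real)" m .
  let ?D = "cap_matrix (cup_matrix A) C" and ?A = "map_mat real A"
  have D: "dim_row ?D = length (florets (cup_matrix A) C)" "dim_col ?D = m"
    using partition_matrixD(1)[OF C] by (simp_all add: cap_matrix_def)
  have rowAt: "dim_row At = dim_row A" and colsAt: "set (cols At) = set (cols A)"
    using At by (auto simp: compression_def)
  fix d assume "d \<in> set (rows (map_mat real ?D))"
  then obtain t where t: "t < dim_row ?D" "d = row (map_mat real ?D) t"
    by (auto simp: rows_def)
  obtain c :: "nat \<Rightarrow> rat" where c: "\<forall>x<dim_col At.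
      of_int (if t = upper_floret_index A C (col At x) then 1 else 0)
        = (\<Sum>i<dim_row At. c i * of_nat (At $$ (i, x)))"
    using degree_combination_of_rows[OF hom, of t] by blast
  \<comment> \<open>The rational coefficients, cast to reals, form the vector whose image under the
    transpose is the row \<open>d\<close>.\<close>
  define y where "y = vec (dim_row A) (\<lambda>i. real_of_rat (c i))"
  have "d = transpose_mat ?A *\<^sub>v y"
  proof (rule eq_vecI)
    fix j assume "j < dim_vec (transpose_mat ?A *\<^sub>v y)"
    then have j: "j < m" using A by simp
    \<comment> \<open>A compression keeps at least one copy of each column, so an identity valid on
      the columns of \<open>At\<close> holds on those of \<open>A\<close>.\<close>
    then have "col A j \<in> set (cols At)" unfolding colsAt using A by (auto simp: cols_def)
    then obtain x where x: "x < dim_col At" "col At x = col A j" by (auto simp: cols_def)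
    have ent: "At $$ (i, x) = A $$ (i, j)" if "i < dim_row A" for i
      using arg_cong[OF x(2), of "\<lambda>w. w $ i"] that rowAt x(1) j A by simp
    have "?D $$ (t, j) = (if t = upper_floret_index A C (col A j) then 1 else 0)"
      using upper_floret_index_eq_iff[OF C A fl j, of t] t D j
      by (auto simp: cap_matrix_def split: if_splits)
    then have "real (?D $$ (t, j))
        = real_of_rat (of_int (if t = upper_floret_index A C (col At x) then 1 else 0))"
      unfolding x by simp
    also have "\<dots> = real_of_rat (\<Sum>i<dim_row At. c i * of_nat (At $$ (i, x)))"
      using c x by metis
    also have "\<dots> = (\<Sum>i<dim_row A. real_of_rat (c i) * real (A $$ (i, j)))"
      unfolding rowAt of_rat_sum by (intro sum.cong) (simp_all add: of_rat_mult ent)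
    also have "\<dots> = (transpose_mat ?A *\<^sub>v y) $ j"
      using j A by (simp add: y_def scalar_prod_def atLeast0LessThan mult.commute)
    finally show "d $ j = (transpose_mat ?A *\<^sub>v y) $ j"
      using t D j by simp
  qed (use t D A in simp)
  moreover have "d \<in> carrier_vec (dim_col ?A)"
    using t(2) D(2) A by (intro carrier_vecI) simp
  moreover have "y \<in> carrier_vec (dim_row ?A)"
    by (intro carrier_vecI) (simp add: y_def)
  moreover have "?A \<in> carrier_mat (dim_row A) m"
    by (rule carrier_matI) (simp_all add: A)
  ultimately show "d \<in> row_space ?A"
    by (subst row_space_eq) blast+
qed

section \<open>Column counts of stacked matrices\<close>

lemma stack_singleton:
  assumes "dim_col B = m"
  shows "stack m [B] = B"
  using assms by (intro eq_matI) (simp_all add: stack_def append_rows_def)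

lemma col_count_snoc:
  assumes tk: "take l As = Bs @ [C]" and Bs: "\<forall>B\<in>set Bs. dim_col B = m"
    and C: "dim_col C = m" and j: "j < m"
  shows "col_count m As l j
    = card {i. i < m \<and> col (stack m Bs) i = col (stack m Bs) j \<and> col C i = col C j}"
  unfolding col_count_def tk
proof (rule arg_cong[where f = card], rule Collect_cong, rule conj_cong[OF refl])
  fix i assume i: "i < m"
  show "col (stack m (Bs @ [C])) i = col (stack m (Bs @ [C])) j \<longleftrightarrow>
      col (stack m Bs) i = col (stack m Bs) j \<and> col C i = col C j"
    unfolding col_stack_snoc[OF Bs C i] col_stack_snoc[OF Bs C j]
    by (rule append_vec_eq_iff) simp
qed

text \<open>For two partitions the only level to check is 2, with \<open>B\<close> alone as level
  1.\<close>

lemma well_connected_pair: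
  assumes "dim_col B = m" "dim_col C = m"
    and ratio: "\<And>u j j'. u < dim_row C \<Longrightarrow> j \<in> row_support C u \<Longrightarrow> j' \<in> row_support C u \<Longrightarrow>
      real (card {i. i < m \<and> col B i = col B j \<and> col C i = col C j})
          / real (card {i. i < m \<and> col B i = col B j}) =
      real (card {i. i < m \<and> col B i = col B j' \<and> col C i = col C j'})
          / real (card {i. i < m \<and> col B i = col B j'})"
  shows "well_connected m [B, C]"
proof -
  have c2: "col_count m [B, C] 2 j
      = card {i. i < m \<and> col B i = col B j \<and> col C i = col C j}" if "j < m" for j
    using col_count_snoc[of 2 "[B, C]" "[B]" C m j] assms(1,2) that
    by (simp add: stack_singleton)
  have c1: "col_count m [B, C] 1 j = card {i. i < m \<and> col B i = col B j}" for j
    using assms(1) by (simp add: col_count_def stack_singleton)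
  show ?thesis
    unfolding well_connected_def
  proof (intro ballI allI impI)
    fix l u j j'
    assume "l \<in> {2..length [B, C]}" and u: "u < dim_row ([B, C] ! (l - 1))"
      and j: "j \<in> row_support ([B, C] ! (l - 1)) u" "j' \<in> row_support ([B, C] ! (l - 1)) u"
    then have l: "l = 2" by simp
    have u: "u < dim_row C" and j: "j \<in> row_support C u" "j' \<in> row_support C u"
      using u j by (simp_all add: l)
    have jm: "j < m" "j' < m"
      using j assms(2) by (simp_all add: row_support_def)
    have "l - 1 = 1" using l by simp
    then show "real (col_count m [B, C] l j) / real (col_count m [B, C] (l - 1) j) =
        real (col_count m [B, C] l j') / real (col_count m [B, C] (l - 1) j')"
      using ratio[OF u j] by (simp only: l c1 c2[OF jm(1)] c2[OF jm(2)])
  qed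
qed

section \<open>From the single fiber products to well-connectedness and the GRIP\<close>

theorem proposition3p20:
  fixes m :: nat and As :: "nat mat list"
  assumes "multipartition m As"
    and "iterated_toric_fiber_product m As"
  shows "well_connected m As \<and> GRIP m As"
proof -
  have part: "partition_matrix m B" if "B \<in> set As" for B
    using assms(1) that by (auto simp: multipartition_def)
  have dim: "dim_col B = m" if "B \<in> set As" for B
    using partition_matrixD(1)[OF part[OF that]] .
  \<comment> \<open>One level at a time, for the stacked matrix \<open>A\<close> itself: the ratio
    identity serves both well-connectedness of the whole list and, via the cup matrix, the first
    GRIP condition.\<close>
  have step: "(\<forall>j<m. \<forall>j'<m. col C j = col C j' \<longrightarrow>
      real (card {i. i < m \<and> col A i = col A j \<and> col C i = col C j})
          / real (card {i. i < m \<and> col A i = col A j}) =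
      real (card {i. i < m \<and> col A i = col A j' \<and> col C i = col C j'})
          / real (card {i. i < m \<and> col A i = col A j'}))
    \<and> floret_condition (cup_matrix A) C
    \<and> set (rows (map_mat real (cap_matrix (cup_matrix A) C)))
        \<subseteq> vec_space.row_space m (map_mat real A)"
    (is "?R \<and> ?F \<and> ?S")
    if l: "l \<in> {1..<length As}" and A_def: "A = stack m (take l As)" and C_def: "C = As ! l"
    for l A C
  proof -
    let ?ix = "\<lambda>At j. upper_floret_index A C (col At j)"
    let ?iy = "\<lambda>Ct j. lower_floret_index A C (col Ct j)"
    let ?P = "\<lambda>At Ct. tfp_vars {..<dim_col At} (?ix At) {..<dim_col Ct} (?iy Ct)"
    have C: "C \<in> set As" using l by (simp add: C_def)
    have tk: "\<forall>B\<in>set (take l As). dim_col B = m" using dim by (auto dest: in_set_takeD)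
    have A: "dim_col A = m" unfolding A_def using tk by (rule stack_carrier(1))
    obtain At Ct \<sigma> where fl: "floret_condition (cup_matrix A) C"
      and At: "compression At A" and Ct: "compression Ct C"
      and tfp: "tfp_defined (\<lambda>t s :: nat. if s = t then 1 else 0) (?ix At) (?iy Ct)
        (toric_ideal At) (toric_ideal Ct)"
      and \<sigma>: "bij_betw \<sigma> (?P At Ct) {..<m}"
      and col\<sigma>: "\<forall>(i, j)\<in>?P At Ct. col (stack m (take (l + 1) As)) (\<sigma> (i, j)) = col At i @\<^sub>v col Ct j"
      using bspec[OF assms(2)[unfolded iterated_toric_fiber_product_def Let_def] l,
          folded A_def C_def]
      by (elim conjE exE) (rule that, assumption+)
    have "take (l + 1) As = take l As @ [C]"
      using l by (simp add: C_def take_Suc_conv_app_nth)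
    then have colA': "col (stack m (take (l + 1) As)) j = col A j @\<^sub>v col C j" if "j < m" for j
      using col_stack_snoc[OF tk dim[OF C] that] by (simp add: A_def)
    \<comment> \<open>Concatenations can be compared blockwise because a compression has as many
      rows as the original matrix.\<close>
    have split: "col A (\<sigma> (x, y)) = col At x \<and> col C (\<sigma> (x, y)) = col Ct y"
      if "(x, y) \<in> ?P At Ct" for x y
    proof -
      have "\<sigma> (x, y) < m" using bij_betw_apply[OF \<sigma> that] unfolding lessThan_iff .
      from colA'[OF this] have "col A (\<sigma> (x, y)) @\<^sub>v col C (\<sigma> (x, y)) = col At x @\<^sub>v col Ct y"
        using bspec[OF col\<sigma> that] unfolding case_prod_conv by (rule trans[OF sym])
      moreover have "dim_vec (col A (\<sigma> (x, y))) = dim_vec (col At x)"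
        using At unfolding compression_def dim_col by (rule conjunct1[THEN sym])
      ultimately show ?thesis by (simp only: append_vec_eq_iff)
    qed
    have R: "real (card {i\<in>{..<m}. col A i = col A j \<and> col C i = col C j})
          / real (card {i\<in>{..<m}. col A i = col A j}) =
        real (card {i\<in>{..<m}. col A i = col A j' \<and> col C i = col C j'})
          / real (card {i\<in>{..<m}. col A i = col A j'})"
      if "j < m" "j' < m" "col C j = col C j'" for j j'
      by (rule fiber_product_column_ratio[where g = "upper_floret_index A C" and p = "col At"
            and h = "lower_floret_index A C" and q = "col Ct",
            OF finite_lessThan finite_lessThan \<sigma>])
        (use split that in blast)+
    have ?R
      by (intro allI impI) (rule R[unfolded lessThan_iff])
    moreover have ?S
      using cap_matrix_rows_in_row_space[OF part[OF C] A fl At] tfp unfolding tfp_defined_def by blast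
    ultimately show ?thesis using fl by blast
  qed
  have "well_connected m As"
    unfolding well_connected_def
  proof (intro ballI allI impI)
    fix k u j j'
    assume k: "k \<in> {2..length As}" and u: "u < dim_row (As ! (k - 1))"
      and j: "j \<in> row_support (As ! (k - 1)) u" "j' \<in> row_support (As ! (k - 1)) u"
    \<comment> \<open>The definition numbers partitions from 1, so the partition numbered
      \<open>k\<close> is \<open>As ! l\<close>, standing below the first \<open>l\<close>
      ones.\<close>
    define l where "l = k - 1"
    define A where "A = stack m (take l As)"
    define C where "C = As ! l"
    have l: "l \<in> {1..<length As}" and kl: "k = l + 1" using k by (auto simp: l_def)
    have C: "C \<in> set As" using l by (simp add: C_def)
    have jm: "j < m" "j' < m" "col C j = col C j'"
      by (rule partition_matrix_same_row[OF part[OF C], of u j j']; use u j in \<open>simp only: C_def l_def\<close>)+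
    have tk: "\<forall>B\<in>set (take l As). dim_col B = m" using dim by (auto dest: in_set_takeD)
    have "take k As = take l As @ [C]"
      using l by (simp add: C_def kl take_Suc_conv_app_nth)
    note ck = col_count_snoc[OF this tk dim[OF C], folded A_def]
    have ck': "col_count m As (k - 1) i = card {i'. i' < m \<and> col A i' = col A i}" for i
      by (simp add: col_count_def A_def l_def)
    then show "real (col_count m As k j) / real (col_count m As (k - 1) j) =
        real (col_count m As k j') / real (col_count m As (k - 1) j')"
      using step[OF l A_def C_def] jm unfolding ck' ck[OF jm(1)] ck[OF jm(2)] by blast
  qed
  moreover have "GRIP m As"
    unfolding GRIP_def Let_def
  proof (intro ballI)
    fix l assume l: "l \<in> {1..<length As}"
    define A where "A = stack m (take l As)"
    define C where "C = As ! l"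
    have C: "C \<in> set As" using l by (simp add: C_def)
    have "\<forall>B\<in>set (take l As). dim_col B = m" using dim by (auto dest: in_set_takeD)
    then have A: "dim_col A = m" unfolding A_def by (rule stack_carrier(1))
    have "well_connected m [cup_matrix A, C]"
    proof (rule well_connected_pair)
      fix u j j' assume "u < dim_row C" "j \<in> row_support C u" "j' \<in> row_support C u"
      note jm = partition_matrix_same_row[OF part[OF C] this]
      \<comment> \<open>Both counts are rewritten from the cup matrix to \<open>A\<close>, where
        \<open>step\<close> applies.\<close>
      have cup: "{i. i < m \<and> col (cup_matrix A) i = col (cup_matrix A) i' \<and> Q i}
          = {i. i < m \<and> col A i = col A i' \<and> Q i}" if "i' < m" for i' Q
        using col_cup_matrix_eq_iff[of _ A i'] A that by blast
      have cup': "{i. i < m \<and> col (cup_matrix A) i = col (cup_matrix A) i'}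
          = {i. i < m \<and> col A i = col A i'}" if "i' < m" for i'
        using col_cup_matrix_eq_iff[of _ A i'] A that by blast
      show "real (card {i. i < m \<and> col (cup_matrix A) i = col (cup_matrix A) j \<and> col C i = col C j})
          / real (card {i. i < m \<and> col (cup_matrix A) i = col (cup_matrix A) j}) =
        real (card {i. i < m \<and> col (cup_matrix A) i = col (cup_matrix A) j' \<and> col C i = col C j'})
          / real (card {i. i < m \<and> col (cup_matrix A) i = col (cup_matrix A) j'})"
        unfolding cup[OF jm(1)] cup[OF jm(2)] cup'[OF jm(1)] cup'[OF jm(2)]
        using step[OF l A_def C_def] jm by blast
    qed (use A dim[OF C] in simp_all)
    then show "well_connected m [cup_matrix (stack m (take l As)), As ! l] \<and>
        floret_condition (cup_matrix (stack m (take l As))) (As ! l) \<and>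
        set (rows (map_mat real (cap_matrix (cup_matrix (stack m (take l As))) (As ! l))))
          \<subseteq> vec_space.row_space m (map_mat real (stack m (take l As)))"
      using step[OF l A_def C_def] unfolding A_def C_def by blast
  qed
  ultimately show ?thesis ..
qed

end
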